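(* Let $S,T$ be disjoint finite sets, $\mu$ a probability measure on $\{0,1\}^S$ and $\nu$ a probability measure on $\{0,1\}^T$, and let $\mu\times\nu$ be the product measure on $\{0,1\}^{S\cup T}$, $\mu\times\nu(\xi,\eta)=\mu(\xi)\nu(\eta)$. (a) If $\mu$ and $\nu$ are APU, then $\mu\times\nu$ is APU. (b) If $\mu$ and $\nu$ are CAPU, then $\mu\times\nu$ is CAPU.
   Context: Write $|\eta|=\sum\eta_i$, $\mathbf{1}=(1,\dots,1)$. For a probability measure $\rho$ on $\{0,1\}^U$ with $|U|=m$, $\gamma_i(\rho)=\binom{m}{i}^{-1}\sum\{\rho(\eta)\rho(\mathbf{1}-\eta):\eta\in\{0,1\}^U,|\eta|=i\}$. A sequence $(c_0,\dots,c_m)$ is unimodal if there is $k$ with $c_0\le\cdots\le c_k\ge\cdots\ge c_m$. $\rho$ is antipodal pairs unimodal (APU) if $(\gamma_i(\rho))_{i=0}^m$ is unimodal. Conditioning $\rho$ means passing to $\rho(\cdot\mid\eta_i=\xi_i\ \forall i\in I)$ for some $I\subseteq U$, $\xi\in\{0,1\}^I$ with positive probability, regarded as a measure on $\{0,1\}^{U\setminus I}$; $\rho$ is CAPU if every measure obtained from $\rho$ by conditioning is APU. *)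

theory Defs
  imports "HOL-Probability.Probability"
begin

text \<open>
  The cube \<open>{0,1}\<^sup>U\<close> is rendered by extensional functions (with value \<open>undefined\<close> outside \<open>U\<close>).
  A probability measure on it, for finite \<open>U\<close>, is a probability mass function supported in the cube.
\<close>

definition cube :: "'a set \<Rightarrow> ('a \<Rightarrow> nat) set" where
  "cube U = U \<rightarrow>\<^sub>E {0, 1}"

definition measure_on_cube :: "'a set \<Rightarrow> ('a \<Rightarrow> nat) pmf \<Rightarrow> bool" where
  "measure_on_cube U \<rho> \<longleftrightarrow> set_pmf \<rho> \<subseteq> cube U"

definition weight :: "'a set \<Rightarrow> ('a \<Rightarrow> nat) \<Rightarrow> nat" where
  "weight U \<eta> = (\<Sum>j\<in>U. \<eta> j)"

definition antipode :: "'a set \<Rightarrow> ('a \<Rightarrow> nat) \<Rightarrow> ('a \<Rightarrow> nat)" where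
  "antipode U \<eta> = (\<lambda>j\<in>U. 1 - \<eta> j)"

definition antipodal_avg :: "'a set \<Rightarrow> ('a \<Rightarrow> nat) pmf \<Rightarrow> nat \<Rightarrow> real" where
  "antipodal_avg U \<rho> i =
     (\<Sum>\<eta> \<in> {\<eta> \<in> cube U. weight U \<eta> = i}. pmf \<rho> \<eta> * pmf \<rho> (antipode U \<eta>))
       / real (card U choose i)"

text \<open>Unimodality of the finite sequence \<open>c 0, \<dots>, c m\<close>; values beyond \<open>m\<close> are irrelevant.\<close>

definition unimodal :: "nat \<Rightarrow> (nat \<Rightarrow> real) \<Rightarrow> bool" where
  "unimodal m c \<longleftrightarrow>
     (\<exists>k\<le>m. (\<forall>i<k. c i \<le> c (Suc i)) \<and> (\<forall>i. k \<le> i \<and> i < m \<longrightarrow> c i \<ge> c (Suc i)))"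

definition APU :: "'a set \<Rightarrow> ('a \<Rightarrow> nat) pmf \<Rightarrow> bool" where
  "APU U \<rho> \<longleftrightarrow> unimodal (card U) (antipodal_avg U \<rho>)"

definition agreeing :: "'a set \<Rightarrow> ('a \<Rightarrow> nat) \<Rightarrow> ('a \<Rightarrow> nat) set" where
  "agreeing I \<xi> = {\<eta>. \<forall>i\<in>I. \<eta> i = \<xi> i}"

text \<open>
  Conditioning on \<open>\<eta>\<^sub>i = \<xi>\<^sub>i\<close> for \<open>i \<in> I\<close>, regarded as a measure on \<open>{0,1}\<close> to the power \<open>U - I\<close>.
  It is meaningful only if the event has positive probability
  (otherwise \<^const>\<open>cond_pmf\<close> is unspecified).
\<close>

definition conditioned ::
    "'a set \<Rightarrow> 'a set \<Rightarrow> ('a \<Rightarrow> nat) \<Rightarrow> ('a \<Rightarrow> nat) pmf \<Rightarrow> ('a \<Rightarrow> nat) pmf" where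
  "conditioned U I \<xi> \<rho> = map_pmf (\<lambda>\<eta>. restrict \<eta> (U - I)) (cond_pmf \<rho> (agreeing I \<xi>))"

definition CAPU :: "'a set \<Rightarrow> ('a \<Rightarrow> nat) pmf \<Rightarrow> bool" where
  "CAPU U \<rho> \<longleftrightarrow>
     (\<forall>I \<xi>. I \<subseteq> U \<and> \<xi> \<in> cube I \<and> measure_pmf.prob \<rho> (agreeing I \<xi>) > 0
        \<longrightarrow> APU (U - I) (conditioned U I \<xi> \<rho>))"

text \<open>
  The product measure on \<open>{0,1}\<close> to the power \<open>S \<union> T\<close>, identified with pairs through \<^const>\<open>merge\<close>;
  see \<open>pmf_cube_prod\<close> for the defining formula.
\<close>

definition cube_prod ::
    "'a set \<Rightarrow> 'a set \<Rightarrow> ('a \<Rightarrow> nat) pmf \<Rightarrow> ('a \<Rightarrow> nat) pmf \<Rightarrow> ('a \<Rightarrow> nat) pmf" where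
  "cube_prod S T \<mu> \<nu> = map_pmf (merge S T) (pair_pmf \<mu> \<nu>)"

lemma merge_in_cube:
  assumes "\<xi> \<in> cube S" "\<eta> \<in> cube T"
  shows "merge S T (\<xi>, \<eta>) \<in> cube (S \<union> T)"
  using assms by (auto simp: cube_def merge_def PiE_iff extensional_def split: if_splits)

lemma inj_on_merge_cube:
  assumes "S \<inter> T = {}"
  shows "inj_on (merge S T) (cube S \<times> cube T)"
proof (rule inj_onI, clarify)
  fix a b a' b'
  assume ab: "a \<in> cube S" "b \<in> cube T" "a' \<in> cube S" "b' \<in> cube T"
    and eq: "merge S T (a, b) = merge S T (a', b')"
  have "a x = a' x \<and> b x = b' x" for x
    using fun_cong[OF eq, of x] ab assms
    by (cases "x \<in> S"; cases "x \<in> T")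
       (auto simp: cube_def merge_def PiE_iff extensional_def)
  then show "a = a' \<and> b = b'" by auto
qed

lemma measure_on_cube_prod:
  assumes "measure_on_cube S \<mu>" "measure_on_cube T \<nu>"
  shows "measure_on_cube (S \<union> T) (cube_prod S T \<mu> \<nu>)"
  using assms merge_in_cube by (fastforce simp: measure_on_cube_def cube_prod_def)

lemma pmf_cube_prod:
  assumes "S \<inter> T = {}" "measure_on_cube S \<mu>" "measure_on_cube T \<nu>"
    and "\<xi> \<in> cube S" "\<eta> \<in> cube T"
  shows "pmf (cube_prod S T \<mu> \<nu>) (merge S T (\<xi>, \<eta>)) = pmf \<mu> \<xi> * pmf \<nu> \<eta>"
proof -
  have "measure_pmf.prob (pair_pmf \<mu> \<nu>) (merge S T -` {merge S T (\<xi>, \<eta>)})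
      = measure_pmf.prob (pair_pmf \<mu> \<nu>) {(\<xi>, \<eta>)}"
  proof (rule measure_prob_cong_0)
    fix p assume "p \<in> merge S T -` {merge S T (\<xi>, \<eta>)} - {(\<xi>, \<eta>)}"
    then have "p \<notin> cube S \<times> cube T"
      using inj_onD[OF inj_on_merge_cube[OF assms(1)], of p "(\<xi>, \<eta>)"] assms(4,5) by auto
    then have "p \<notin> set_pmf (pair_pmf \<mu> \<nu>)"
      using assms(2,3) by (auto simp: measure_on_cube_def)
    then show "pmf (pair_pmf \<mu> \<nu>) p = 0"
      by (simp add: set_pmf_iff del: set_pair_pmf)
  qed auto
  then show ?thesis
    by (simp add: cube_prod_def pmf_map measure_pmf_single pmf_pair)
qed

lemma pmf_conditioned:
  assumes "I \<subseteq> U" "measure_on_cube U \<rho>" "\<xi> \<in> cube I" "\<zeta> \<in> cube (U - I)"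
    and pos: "measure_pmf.prob \<rho> (agreeing I \<xi>) > 0"
  shows "pmf (conditioned U I \<xi> \<rho>) \<zeta>
    = pmf \<rho> (merge I (U - I) (\<xi>, \<zeta>)) / measure_pmf.prob \<rho> (agreeing I \<xi>)"
proof -
  let ?m = "merge I (U - I) (\<xi>, \<zeta>)" and ?c = "cond_pmf \<rho> (agreeing I \<xi>)"
  have ne: "set_pmf \<rho> \<inter> agreeing I \<xi> \<noteq> {}"
    using pos by (metis measure_Int_set_pmf inf_commute measure_empty less_irrefl)
  have "measure_pmf.prob ?c ((\<lambda>\<eta>. restrict \<eta> (U - I)) -` {\<zeta>}) = measure_pmf.prob ?c {?m}"
  proof (rule measure_prob_cong_0)
    fix \<eta> assume h: "\<eta> \<in> (\<lambda>\<eta>. restrict \<eta> (U - I)) -` {\<zeta>} - {?m}"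
    have "\<eta> = ?m" if "\<eta> \<in> cube U" "\<eta> \<in> agreeing I \<xi>"
    proof
      fix x
      have "restrict \<eta> (U - I) x = \<zeta> x" using h by auto
      then show "\<eta> x = ?m x"
        using that assms(1)
        by (cases "x \<in> I"; cases "x \<in> U")
           (auto simp: merge_def agreeing_def cube_def PiE_iff extensional_def)
    qed
    then have "\<eta> \<notin> set_pmf ?c"
      using h assms(2) by (auto simp: set_cond_pmf[OF ne] measure_on_cube_def)
    then show "pmf ?c \<eta> = 0" by (simp add: set_pmf_iff)
  next
    fix \<eta> assume "\<eta> \<in> {?m} - (\<lambda>\<eta>. restrict \<eta> (U - I)) -` {\<zeta>}"
    moreover have "restrict ?m (U - I) = \<zeta>"
      using assms(4) by (auto simp: fun_eq_iff merge_def cube_def PiE_iff extensional_def)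
    ultimately show "pmf ?c \<eta> = 0" by auto
  qed
  moreover have "?m \<in> agreeing I \<xi>"
    by (auto simp: agreeing_def merge_def)
  ultimately show ?thesis
    by (simp add: conditioned_def pmf_map measure_pmf_single pmf_cond[OF ne])
qed

end

theory Submission
  imports Defs
begin

text \<open>
  The sequences \<open>\<alpha> = \<gamma>(\<mu>)\<close> and \<open>\<beta> = \<gamma>(\<nu>)\<close> are symmetric, so unimodality means being
  increasing on the first half. With \<open>m = |S|\<close> and \<open>n = |T|\<close>, \<open>\<gamma>\<^sub>k(\<mu> \<times> \<nu>)\<close> is the expectation of
  \<open>\<alpha>\<^sub>i \<beta>\<^sub>j\<close> where \<open>(i, j)\<close> is the position at time \<open>k\<close> of a uniformly random monotone lattice path
  from \<open>(0, 0)\<close> to \<open>(m, n)\<close>. By Pascal's rule its increment from \<open>k\<close> to \<open>k + 1\<close> is a sum over the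
  horizontal edges of that level, with differences of \<open>\<alpha>\<close>, and over the vertical ones, with differences of \<open>\<beta>\<close>.
  These differences are antisymmetric; pairing the edge leaving column \<open>i\<close> with the one leaving
  column \<open>m - 1 - i\<close>, the one in the left half carries both the larger number of paths and the
  larger \<open>\<beta>\<close>-value as long as \<open>2 k < m + n\<close>, so each pair contributes nonnegatively.
  The conditioned case reduces to this one, because conditioning commutes with products.
\<close>

section \<open>Binomial coefficients and symmetric unimodal sequences\<close>

text \<open>For \<open>r \<le> B\<close>, raising \<open>B\<close> by one multiplies
  \<open>B choose r\<close> by \<open>Suc B / (Suc B - r)\<close>, which grows with
  \<open>r\<close>; so the equality at \<open>B = A\<close> degrades only in the right
  direction.\<close>

lemma binomial_log_supermodular:
  fixes A B p q :: nat
  assumes "A \<le> B" "p \<le> q"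
  shows "(A choose q) * (B choose p) \<le> (A choose p) * (B choose q)"
  using assms(1)
proof (induction rule: dec_induct)
  case base
  show ?case by simp
next
  case (step B)
  show ?case
  proof (cases "q \<le> A")
    case False
    then have "(A choose q) = 0" by (simp add: binomial_eq_0)
    then show ?thesis by (simp only: mult_zero_left zero_le)
  next
    case True
    have ab: "Suc B * (B choose r) = (Suc B - r) * (Suc B choose r)" for r
      using binomial_absorb_comp[of "Suc B" r] by simp
    \<comment> \<open>The product of the two denominators; it is positive because
      \<open>q \<le> A \<le> B\<close>, so it can be cancelled at the end.\<close>
    let ?d = "(Suc B - p) * (Suc B - q)"
    have "?d * ((A choose q) * (Suc B choose p)) = (Suc B - q) * (Suc B * ((A choose q) * (B choose p)))"
      unfolding mult.left_commute[of "Suc B"] ab[of p] by (simp only: ac_simps)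
    also have "\<dots> \<le> (Suc B - p) * (Suc B * ((A choose p) * (B choose q)))"
      using assms(2) step.IH by (rule mult_le_mono[OF diff_le_mono2 mult_le_mono2])
    also have "\<dots> = ?d * ((A choose p) * (Suc B choose q))"
      unfolding mult.left_commute[of "Suc B"] ab[of q] by (simp only: ac_simps)
    finally show ?thesis
      using step.hyps True assms(2) by simp
  qed
qed

lemma unimodal_symmetric_iff:
  assumes sym: "\<And>i. i \<le> m \<Longrightarrow> c (m - i) = c i"
  shows "unimodal m c \<longleftrightarrow> (\<forall>i. 2 * i < m \<longrightarrow> c i \<le> c (Suc i))"
proof
  assume "unimodal m c"
  then obtain k where k: "\<And>i. i < k \<Longrightarrow> c i \<le> c (Suc i)"
      "\<And>i. k \<le> i \<Longrightarrow> i < m \<Longrightarrow> c (Suc i) \<le> c i"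
    unfolding unimodal_def by blast
  show "\<forall>i. 2 * i < m \<longrightarrow> c i \<le> c (Suc i)"
  proof (intro allI impI)
    fix i assume i: "2 * i < m"
    show "c i \<le> c (Suc i)"
    proof (cases "i < k")
      case False
      \<comment> \<open>Beyond the peak the sequence decreases, and the mirror image
        \<open>m - i\<close> of \<open>i\<close> is at least \<open>Suc i\<close>.\<close>
      have "c j \<le> c (Suc i)" if "Suc i \<le> j" "j \<le> m" for j
        using that
      proof (induction j rule: dec_induct)
        case (step j)
        then show ?case using k(2)[of j] False by simp
      qed simp
      from this[of "m - i"] show ?thesis using i sym[of i] by simp
    qed (use k in auto)
  qed
next
  assume inc: "\<forall>i. 2 * i < m \<longrightarrow> c i \<le> c (Suc i)"
  \<comment> \<open>The step from \<open>i\<close> to \<open>Suc i\<close> mirrors the one from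
    \<open>m - Suc i\<close> to \<open>m - i\<close> in the left half. If
    \<open>2 * i + 1 = m\<close>, the two entries are mirror images of each other and hence
    equal.\<close>
  have "c (Suc i) \<le> c i" if "m div 2 \<le> i" "i < m" for i
  proof (cases "2 * i + 1 = m")
    case True
    then have "m - i = Suc i" by simp
    then show ?thesis using sym[of i] that by simp
  next
    case False
    then have "2 * (m - Suc i) < m" using that by linarith
    then have "c (m - Suc i) \<le> c (m - i)" using inc that by (metis Suc_diff_Suc)
    then show ?thesis using sym[of i] sym[of "Suc i"] that by simp
  qed
  then show "unimodal m c"
    unfolding unimodal_def using inc by (intro exI[of _ "m div 2"]) auto
qed

text \<open>The index conditions place \<open>j\<close> between \<open>i\<close> and its mirror
  image \<open>m - i\<close>, hence no farther from the centre; a \<open>j\<close> in the right half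
  is reflected first.\<close>

lemma symmetric_unimodal_mono:
  fixes c :: "nat \<Rightarrow> real"
  assumes sym: "\<And>i. i \<le> m \<Longrightarrow> c (m - i) = c i"
    and inc: "\<And>i. 2 * i < m \<Longrightarrow> c i \<le> c (Suc i)"
    and "i \<le> j" "i + j \<le> m"
  shows "c i \<le> c j"
proof -
  have half: "c i \<le> c j" if "i \<le> j" "2 * j \<le> m" for j
    using that
  proof (induction j rule: dec_induct)
    case (step j)
    then show ?case using inc[of j] by simp
  qed simp
  show ?thesis
  proof (cases "2 * j \<le> m")
    case True
    then show ?thesis using half assms(3) by simp
  next
    case False
    then have "c i \<le> c (m - j)" using assms(4) by (intro half) auto
    then show ?thesis using sym[of j] assms(4) by simp
  qed
qed

section \<open>Lattice path sums and their increments\<close>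

text \<open>The binomials count the ways to reach the horizontal edge from \<open>(i, k - i)\<close>
  to \<open>(i + 1, k - i)\<close> and to continue after it. Vertical edges are covered by
  exchanging \<open>m\<close>, \<open>\<alpha>\<close> with \<open>n\<close>,
  \<open>\<beta>\<close>.\<close>

lemma edge_sum_nonneg:
  fixes \<alpha> \<beta> :: "nat \<Rightarrow> real"
  assumes symA: "\<And>i. i \<le> m \<Longrightarrow> \<alpha> (m - i) = \<alpha> i"
    and incA: "\<And>i. 2 * i < m \<Longrightarrow> \<alpha> i \<le> \<alpha> (Suc i)"
    and symB: "\<And>j. j \<le> n \<Longrightarrow> \<beta> (n - j) = \<beta> j"
    and incB: "\<And>j. 2 * j < n \<Longrightarrow> \<beta> j \<le> \<beta> (Suc j)"
    and nonneg: "\<And>j. 0 \<le> \<beta> j"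
    and k: "2 * k < m + n"
  shows "0 \<le> (\<Sum>i<m. real (k choose i) * real ((m + n - 1 - k) choose (m - 1 - i))
                 * (\<alpha> (Suc i) - \<alpha> i) * \<beta> (k - i))"
proof -
  define B where "B = m + n - 1 - k"
  define g where "g i = real (k choose i) * real (B choose (m - 1 - i))
                 * (\<alpha> (Suc i) - \<alpha> i) * \<beta> (k - i)" for i
  \<comment> \<open>\<open>B\<close> steps remain after the edge; this is the order that makes the
    left edge of a pair carry more paths.\<close>
  have kB: "k \<le> B" using k by (simp add: B_def)
  have low: "0 \<le> g i + g (m - Suc i)" if i: "i < m" "2 * i < m" for i
  proof -
    define q where "q = m - 1 - i"
    have q: "i \<le> q" "i + q + 1 = m" using i by (auto simp: q_def)
    have antisym: "\<alpha> (Suc q) - \<alpha> q = - (\<alpha> (Suc i) - \<alpha> i)"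
      using symA[of i] symA[of "Suc i"] q by (simp add: q_def Suc_diff_Suc i)
    have "g i + g q = (\<alpha> (Suc i) - \<alpha> i) *
        (real ((k choose i) * (B choose q)) * \<beta> (k - i) - real ((k choose q) * (B choose i)) * \<beta> (k - q))"
      unfolding g_def antisym using q by (simp add: algebra_simps flip: q(2))
    moreover have "real ((k choose q) * (B choose i)) * \<beta> (k - q)
        \<le> real ((k choose i) * (B choose q)) * \<beta> (k - i)"
    proof (cases "q \<le> k")
      case True
      \<comment> \<open>The two indices add up to \<open>2 * k - (m - 1)\<close>, at most
        \<open>n\<close>. For \<open>q > k\<close> truncation could break this bound, but then
        \<open>k choose q\<close> is zero.\<close>
      have "\<beta> (k - q) \<le> \<beta> (k - i)"
      proof (rule symmetric_unimodal_mono[OF symB incB])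
        show "k - q \<le> k - i" "k - q + (k - i) \<le> n" using q k True by linarith+
      qed
      then show ?thesis
        using binomial_log_supermodular[OF kB q(1)] nonneg
        by (intro mult_mono) (auto simp flip: of_nat_mult)
    qed (use nonneg in \<open>simp add: binomial_eq_0\<close>)
    ultimately show ?thesis
      using incA[OF i(2)] q by (simp add: q_def)
  qed
  have "0 \<le> g i + g (m - Suc i)" if "i < m" for i
  proof (cases "2 * i < m")
    case False
    then have "0 \<le> g (m - Suc i) + g (m - Suc (m - Suc i))" using that by (intro low) auto
    then show ?thesis using that by (simp add: Suc_diff_Suc add.commute)
  qed (use low that in auto)
  then have "0 \<le> (\<Sum>i<m. g i + g (m - Suc i))" by (intro sum_nonneg) auto
  also have "\<dots> = 2 * (\<Sum>i<m. g i)"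
    by (simp add: sum.distrib sum.nat_diff_reindex)
  finally show ?thesis by (simp add: g_def B_def)
qed

text \<open>
  For \<open>k \<le> m + n\<close> the weight counts the lattice paths from \<open>(0, 0)\<close> to \<open>(m, n)\<close> through \<open>(i, k - i)\<close>;
  it vanishes when \<open>k < i\<close> or \<open>n < k - i\<close>, so truncated subtraction is harmless there.
\<close>

definition path_sum :: "nat \<Rightarrow> nat \<Rightarrow> (nat \<Rightarrow> real) \<Rightarrow> (nat \<Rightarrow> real) \<Rightarrow> nat \<Rightarrow> real" where
  "path_sum m n \<alpha> \<beta> k =
     (\<Sum>i\<le>m. real (k choose i) * real ((m + n - k) choose (m - i)) * \<alpha> i * \<beta> (k - i))"

lemma path_sum_diff:
  assumes k: "k < m + n"
  shows "path_sum m n \<alpha> \<beta> (Suc k) - path_sum m n \<alpha> \<beta> k =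
      (\<Sum>i<m. real (k choose i) * real ((m + n - 1 - k) choose (m - 1 - i))
                 * (\<alpha> (Suc i) - \<alpha> i) * \<beta> (k - i)) +
      (\<Sum>j<n. real (k choose j) * real ((n + m - 1 - k) choose (n - 1 - j))
                 * (\<beta> (Suc j) - \<beta> j) * \<alpha> (k - j))"
proof -
  define B where "B = m + n - 1 - k"
  have B: "m + n - Suc k = B" "m + n - k = Suc B" using k by (auto simp: B_def)
  \<comment> \<open>Pascal's rule for \<open>Suc k choose i\<close> splits the paths by the step
    that arrives at level \<open>Suc k\<close>: vertical in the first sum, horizontal, re-indexed by
    its starting column, in the second.\<close>
  have up: "path_sum m n \<alpha> \<beta> (Suc k) =
      (\<Sum>i\<le>m. real (k choose i) * real (B choose (m - i)) * \<alpha> i * \<beta> (Suc k - i)) +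
      (\<Sum>i<m. real (k choose i) * real (B choose (m - 1 - i)) * \<alpha> (Suc i) * \<beta> (k - i))"
  proof (cases m)
    case (Suc m')
    have B': "Suc m' + n - Suc k = B" using B(1) Suc by simp
    show ?thesis unfolding path_sum_def Suc B' lessThan_Suc_atMost sum.atMost_Suc_shift
      by (simp add: algebra_simps sum.distrib)
  qed (simp add: path_sum_def B)
  \<comment> \<open>Pascal's rule for \<open>Suc B choose (m - i)\<close> splits by the step that
    leaves level \<open>k\<close>. Column \<open>m\<close> is set apart, since only a vertical step
    can leave it.\<close>
  have down: "path_sum m n \<alpha> \<beta> k =
      (\<Sum>i\<le>m. real (k choose i) * real (B choose (m - i)) * \<alpha> i * \<beta> (k - i)) +
      (\<Sum>i<m. real (k choose i) * real (B choose (m - 1 - i)) * \<alpha> i * \<beta> (k - i))"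
  proof -
    have "path_sum m n \<alpha> \<beta> k = (\<Sum>i<m. real (k choose i) * real (Suc B choose (m - i)) * \<alpha> i * \<beta> (k - i))
        + real (k choose m) * \<alpha> m * \<beta> (k - m)"
      unfolding path_sum_def B by (simp flip: lessThan_Suc_atMost)
    also have "(\<Sum>i<m. real (k choose i) * real (Suc B choose (m - i)) * \<alpha> i * \<beta> (k - i)) =
      (\<Sum>i<m. real (k choose i) * (real (B choose (m - i)) + real (B choose (m - 1 - i))) * \<alpha> i * \<beta> (k - i))"
    proof (rule sum.cong)
      fix i assume "i \<in> {..<m}"
      then have "m - i = Suc (m - 1 - i)" by auto
      then have "real (Suc B choose (m - i)) = real (B choose (m - i)) + real (B choose (m - 1 - i))"
        by (metis add.commute binomial_Suc_Suc of_nat_add)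
      then show "real (k choose i) * real (Suc B choose (m - i)) * \<alpha> i * \<beta> (k - i) =
         real (k choose i) * (real (B choose (m - i)) + real (B choose (m - 1 - i))) * \<alpha> i * \<beta> (k - i)"
        by simp
    qed simp
    finally show ?thesis
      by (simp add: algebra_simps sum.distrib flip: lessThan_Suc_atMost)
  qed
  \<comment> \<open>Vertical edges are re-indexed by their starting row \<open>j = k - i\<close>.
    Where neither binomial vanishes this is a bijection, and it replaces each binomial by its
    complementary form.\<close>
  have vert: "(\<Sum>i\<le>m. real (k choose i) * real (B choose (m - i)) * \<alpha> i * (\<beta> (Suc k - i) - \<beta> (k - i)))
    = (\<Sum>j<n. real (k choose j) * real (B choose (n - 1 - j)) * (\<beta> (Suc j) - \<beta> j) * \<alpha> (k - j))"
    (is "sum ?f {..m} = sum ?h {..<n}")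
  proof -
    have "sum ?f {..m} = sum ?f {i. i \<le> m \<and> i \<le> k \<and> m - i \<le> B}"
      by (rule sum.mono_neutral_right) (auto simp: binomial_eq_0)
    also have "\<dots> = sum ?h {j. j < n \<and> j \<le> k \<and> n - 1 - j \<le> B}"
    proof (rule sum.reindex_bij_witness[of _ "\<lambda>j. k - j" "\<lambda>i. k - i"])
      fix i assume i: "i \<in> {i. i \<le> m \<and> i \<le> k \<and> m - i \<le> B}"
      show "k - (k - i) = i" using i by simp
      show "k - i \<in> {j. j < n \<and> j \<le> k \<and> n - 1 - j \<le> B}" using i k by (auto simp: B_def)
      have "B choose (m - i) = B choose (n - 1 - (k - i))"
      proof -
        have "B - (m - i) = n - 1 - (k - i)" using i k by (auto simp: B_def)
        then show ?thesis using i binomial_symmetric[of "m - i" B] by simp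
      qed
      moreover have "k choose (k - i) = k choose i" using i binomial_symmetric[of i k] by simp
      ultimately show "?h (k - i) = ?f i" using i by (simp add: Suc_diff_le)
    qed (use k in \<open>auto simp: B_def\<close>)
    also have "\<dots> = sum ?h {..<n}"
      by (rule sum.mono_neutral_left) (auto simp: binomial_eq_0)
    finally show ?thesis .
  qed
  have "n + m - 1 - k = B" by (simp add: B_def add.commute)
  then show ?thesis
    unfolding up down B_def[symmetric] using vert
    by (simp add: algebra_simps sum_subtractf sum.distrib)
qed

lemma path_sum_mono:
  fixes \<alpha> \<beta> :: "nat \<Rightarrow> real"
  assumes "\<And>i. i \<le> m \<Longrightarrow> \<alpha> (m - i) = \<alpha> i" "\<And>i. 2 * i < m \<Longrightarrow> \<alpha> i \<le> \<alpha> (Suc i)" "\<And>i. 0 \<le> \<alpha> i"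
    and "\<And>j. j \<le> n \<Longrightarrow> \<beta> (n - j) = \<beta> j" "\<And>j. 2 * j < n \<Longrightarrow> \<beta> j \<le> \<beta> (Suc j)" "\<And>j. 0 \<le> \<beta> j"
    and k: "2 * k < m + n"
  shows "path_sum m n \<alpha> \<beta> k \<le> path_sum m n \<alpha> \<beta> (Suc k)"
proof -
  have "0 \<le> path_sum m n \<alpha> \<beta> (Suc k) - path_sum m n \<alpha> \<beta> k"
    using k edge_sum_nonneg[of m \<alpha> n \<beta> k] edge_sum_nonneg[of n \<beta> m \<alpha> k] assms
    by (subst path_sum_diff) (auto simp: add.commute)
  then show ?thesis by simp
qed

text \<open>Double counting of pairs of an \<open>m\<close>-subset (the horizontal steps) and a
  \<open>k\<close>-subset of \<open>m + n\<close> positions that meet in \<open>i\<close> elements,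
  choosing either set first.\<close>

lemma choose_product_path:
  fixes m n k i :: nat
  assumes "i \<le> m" "i \<le> k" "k \<le> m + n"
  shows "(m choose i) * (n choose (k - i)) * ((m + n) choose m)
       = ((m + n) choose k) * ((k choose i) * ((m + n - k) choose (m - i)))"
proof (cases "k - i \<le> n")
  case True
  have "real (m choose i) * real (n choose (k - i)) * real ((m + n) choose m)
       = real ((m + n) choose k) * (real (k choose i) * real ((m + n - k) choose (m - i)))"
  proof -
    have "m + n - k - (m - i) = n - (k - i)" using assms by auto
    then show ?thesis using assms True by (simp add: binomial_fact)
  qed
  then show ?thesis by (metis of_nat_eq_iff of_nat_mult)
next
  case False
  then have "m + n - k < m - i" using assms by auto
  then show ?thesis using False by (simp add: binomial_eq_0)
qed

section \<open>The cube, antipodes and antipodal averages\<close>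

lemma finite_cube: "finite U \<Longrightarrow> finite (cube U)"
  by (simp add: cube_def finite_PiE)

lemma cube_le_1: "\<eta> \<in> cube U \<Longrightarrow> x \<in> U \<Longrightarrow> \<eta> x \<le> 1"
  by (fastforce simp: cube_def PiE_iff)

lemma antipode_in_cube: "antipode U \<eta> \<in> cube U"
  by (auto simp: antipode_def cube_def)

lemma antipode_antipode: "\<eta> \<in> cube U \<Longrightarrow> antipode U (antipode U \<eta>) = \<eta>"
  using cube_le_1[of \<eta> U]
  by (auto simp: antipode_def fun_eq_iff cube_def PiE_iff extensional_def)

lemma weight_antipode:
  assumes "finite U" "\<eta> \<in> cube U"
  shows "weight U (antipode U \<eta>) + weight U \<eta> = card U"
  using cube_le_1[OF assms(2)] by (simp add: weight_def antipode_def flip: sum.distrib)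

text \<open>The unnormalised form of \<open>antipodal_avg\<close>, for which product measures give
  plain convolutions.\<close>

definition antipodal_sum :: "'a set \<Rightarrow> ('a \<Rightarrow> nat) pmf \<Rightarrow> nat \<Rightarrow> real" where
  "antipodal_sum U \<rho> i =
     (\<Sum>\<eta> \<in> {\<eta> \<in> cube U. weight U \<eta> = i}. pmf \<rho> \<eta> * pmf \<rho> (antipode U \<eta>))"

lemma antipodal_avg_nonneg: "0 \<le> antipodal_avg U \<rho> i"
  by (simp add: antipodal_avg_def sum_nonneg)

text \<open>The antipode exchanges the two levels and only swaps the factors of each
  summand.\<close>

lemma antipodal_avg_symmetric:
  assumes "finite U" "i \<le> card U"
  shows "antipodal_avg U \<rho> (card U - i) = antipodal_avg U \<rho> i"
proof -
  have "antipodal_sum U \<rho> (card U - i) = antipodal_sum U \<rho> i"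
    unfolding antipodal_sum_def
  proof (rule sum.reindex_bij_witness[of _ "antipode U" "antipode U"], goal_cases)
    case (2 \<eta>)
    then show ?case using weight_antipode[OF assms(1), of \<eta>] assms(2) by (auto simp: antipode_in_cube)
  next
    case (4 \<eta>)
    then show ?case using weight_antipode[OF assms(1), of \<eta>] assms(2) by (auto simp: antipode_in_cube)
  qed (auto simp: antipode_antipode)
  then show ?thesis
    using assms(2) binomial_symmetric[of i "card U"] by (simp add: antipodal_avg_def antipodal_sum_def)
qed

lemma APU_iff:
  assumes "finite U"
  shows "APU U \<rho> \<longleftrightarrow> (\<forall>i. 2 * i < card U \<longrightarrow> antipodal_avg U \<rho> i \<le> antipodal_avg U \<rho> (Suc i))"
  unfolding APU_def using antipodal_avg_symmetric[OF assms] by (rule unimodal_symmetric_iff)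

lemma antipodal_sum_eq:
  assumes "finite U"
  shows "antipodal_sum U \<rho> i = real (card U choose i) * antipodal_avg U \<rho> i"
proof (cases "i \<le> card U")
  case True
  then show ?thesis by (simp add: antipodal_sum_def antipodal_avg_def)
next
  case False
  \<comment> \<open>Above \<open>card U\<close> both sides are zero, so the convolution can later be
    rewritten without range conditions.\<close>
  have "{\<eta> \<in> cube U. weight U \<eta> = i} = {}"
    using weight_antipode[OF assms] False by force
  then show ?thesis using False unfolding antipodal_sum_def by (simp only: sum.empty) simp
qed

section \<open>Antipodal averages of product measures\<close>

lemma restrict_cube: "\<zeta> \<in> cube U \<Longrightarrow> restrict \<zeta> U = \<zeta>"
  by (auto simp: cube_def PiE_iff extensional_restrict)

lemma restrict_in_cube: "\<zeta> \<in> cube U \<Longrightarrow> A \<subseteq> U \<Longrightarrow> restrict \<zeta> A \<in> cube A"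
  by (auto simp: cube_def PiE_iff)

lemma weight_merge:
  assumes "finite S" "finite T" "S \<inter> T = {}"
  shows "weight (S \<union> T) (merge S T (\<xi>, \<eta>)) = weight S \<xi> + weight T \<eta>"
proof -
  have "weight (S \<union> T) (merge S T (\<xi>, \<eta>))
      = (\<Sum>j\<in>S. merge S T (\<xi>, \<eta>) j) + (\<Sum>j\<in>T. merge S T (\<xi>, \<eta>) j)"
    unfolding weight_def using assms by (rule sum.union_disjoint)
  also have "(\<Sum>j\<in>S. merge S T (\<xi>, \<eta>) j) = weight S \<xi>"
    unfolding weight_def by (rule sum.cong) (auto simp: merge_def)
  also have "(\<Sum>j\<in>T. merge S T (\<xi>, \<eta>) j) = weight T \<eta>"
    unfolding weight_def using assms(3) by (intro sum.cong) (auto simp: merge_def)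
  finally show ?thesis .
qed

lemma antipode_merge:
  "antipode (S \<union> T) (merge S T (\<xi>, \<eta>)) = merge S T (antipode S \<xi>, antipode T \<eta>)"
  by (auto simp: antipode_def merge_def fun_eq_iff)

text \<open>Cutting a point into its parts on \<open>S\<close> and \<open>T\<close> cuts its
  antipode likewise and adds the weights; the sum is then sorted by the weight \<open>i\<close> of
  the part on \<open>S\<close>.\<close>

lemma antipodal_sum_prod:
  assumes fin: "finite S" "finite T" and disj: "S \<inter> T = {}"
    and cubes: "measure_on_cube S \<mu>" "measure_on_cube T \<nu>"
  shows "antipodal_sum (S \<union> T) (cube_prod S T \<mu> \<nu>) k
       = (\<Sum>i\<le>k. antipodal_sum S \<mu> i * antipodal_sum T \<nu> (k - i))"
proof -
  let ?f = "\<lambda>\<xi>. pmf \<mu> \<xi> * pmf \<mu> (antipode S \<xi>)" and ?g = "\<lambda>\<eta>. pmf \<nu> \<eta> * pmf \<nu> (antipode T \<eta>)"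
  let ?X = "\<lambda>i. {\<xi> \<in> cube S. weight S \<xi> = i}" and ?Y = "\<lambda>j. {\<eta> \<in> cube T. weight T \<eta> = j}"
  let ?P = "{p \<in> cube S \<times> cube T. weight S (fst p) + weight T (snd p) = k}"
  have "antipodal_sum (S \<union> T) (cube_prod S T \<mu> \<nu>) k = (\<Sum>p\<in>?P. ?f (fst p) * ?g (snd p))"
    unfolding antipodal_sum_def
  proof (rule sum.reindex_bij_witness[of _ "merge S T" "\<lambda>\<zeta>. (restrict \<zeta> S, restrict \<zeta> T)"], goal_cases)
    case (1 \<zeta>)
    then show ?case by (simp add: restrict_cube)
  next
    case (2 \<zeta>)
    then show ?case
      using weight_merge[OF fin disj, of "restrict \<zeta> S" "restrict \<zeta> T"]
      by (auto simp: restrict_cube restrict_in_cube)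
  next
    case (3 p)
    then show ?case using disj
      by (cases p) (auto simp: fun_eq_iff merge_def cube_def PiE_iff extensional_def)
  next
    case (4 p)
    then show ?case by (cases p) (auto simp: merge_in_cube weight_merge[OF fin disj])
  next
    case (5 \<zeta>)
    then have \<zeta>: "\<zeta> = merge S T (restrict \<zeta> S, restrict \<zeta> T)"
      and r: "restrict \<zeta> S \<in> cube S" "restrict \<zeta> T \<in> cube T"
      by (auto simp: restrict_cube restrict_in_cube)
    have "pmf (cube_prod S T \<mu> \<nu>) \<zeta> = pmf \<mu> (restrict \<zeta> S) * pmf \<nu> (restrict \<zeta> T)"
      by (subst \<zeta>) (rule pmf_cube_prod[OF disj cubes r])
    moreover have "pmf (cube_prod S T \<mu> \<nu>) (antipode (S \<union> T) \<zeta>)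
        = pmf \<mu> (antipode S (restrict \<zeta> S)) * pmf \<nu> (antipode T (restrict \<zeta> T))"
      by (subst \<zeta>, subst antipode_merge)
        (rule pmf_cube_prod[OF disj cubes antipode_in_cube antipode_in_cube])
    ultimately show ?case by simp
  qed
  also have "?P = (\<Union>i\<in>{..k}. ?X i \<times> ?Y (k - i))" by auto
  also have "(\<Sum>p\<in>(\<Union>i\<in>{..k}. ?X i \<times> ?Y (k - i)). ?f (fst p) * ?g (snd p))
      = (\<Sum>i\<le>k. \<Sum>p\<in>?X i \<times> ?Y (k - i). ?f (fst p) * ?g (snd p))"
    using finite_cube[OF fin(1)] finite_cube[OF fin(2)] by (intro sum.UNION_disjoint) auto
  also have "\<dots> = (\<Sum>i\<le>k. antipodal_sum S \<mu> i * antipodal_sum T \<nu> (k - i))"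
    unfolding antipodal_sum_def sum_product sum.cartesian_product by (simp add: case_prod_beta)
  finally show ?thesis .
qed

lemma antipodal_avg_prod:
  assumes fin: "finite S" "finite T" and disj: "S \<inter> T = {}"
    and cubes: "measure_on_cube S \<mu>" "measure_on_cube T \<nu>"
    and k: "k \<le> card S + card T"
  shows "antipodal_avg (S \<union> T) (cube_prod S T \<mu> \<nu>) k
       = path_sum (card S) (card T) (antipodal_avg S \<mu>) (antipodal_avg T \<nu>) k
           / real ((card S + card T) choose card S)"
proof -
  define m n \<alpha> \<beta> where "m = card S" "n = card T" "\<alpha> = antipodal_avg S \<mu>" "\<beta> = antipodal_avg T \<nu>"
  note defs = this
  let ?N = "real ((m + n) choose k)" and ?W = "real ((m + n) choose m)"
  have "?N * antipodal_avg (S \<union> T) (cube_prod S T \<mu> \<nu>) k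
      = (\<Sum>i\<le>k. antipodal_sum S \<mu> i * antipodal_sum T \<nu> (k - i))"
    using antipodal_sum_prod[OF assms(1-5), of k] fin disj
    by (simp add: antipodal_sum_eq card_Un_disjoint defs)
  also have "\<dots> = (\<Sum>i\<le>k. real ((m choose i) * (n choose (k - i))) * (\<alpha> i * \<beta> (k - i)))"
    using fin by (simp add: antipodal_sum_eq defs algebra_simps)
  \<comment> \<open>The factor \<open>?W\<close>, the number of all paths, produces the left side of
    \<open>choose_product_path\<close>. The range changes from \<open>i \<le> k\<close> to
    \<open>i \<le> m\<close> because terms beyond either bound vanish.\<close>
  finally have "?W * (?N * antipodal_avg (S \<union> T) (cube_prod S T \<mu> \<nu>) k)
      = (\<Sum>i\<le>k. real ((m choose i) * (n choose (k - i)) * ((m + n) choose m)) * (\<alpha> i * \<beta> (k - i)))"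
    by (simp add: sum_distrib_left algebra_simps)
  also have "\<dots> = (\<Sum>i\<in>{..k} \<inter> {..m}. real ((m choose i) * (n choose (k - i)) * ((m + n) choose m)) * (\<alpha> i * \<beta> (k - i)))"
    by (rule sum.mono_neutral_right) (auto simp: binomial_eq_0)
  also have "\<dots> = (\<Sum>i\<in>{..k} \<inter> {..m}. ?N * (real (k choose i) * real ((m + n - k) choose (m - i)) * \<alpha> i * \<beta> (k - i)))"
    using k by (intro sum.cong) (auto simp: choose_product_path defs)
  also have "\<dots> = (\<Sum>i\<le>m. ?N * (real (k choose i) * real ((m + n - k) choose (m - i)) * \<alpha> i * \<beta> (k - i)))"
    by (rule sum.mono_neutral_left) (auto simp: binomial_eq_0)
  also have "\<dots> = ?N * path_sum m n \<alpha> \<beta> k"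
    by (simp add: path_sum_def sum_distrib_left)
  finally show ?thesis
    using k by (simp add: field_simps defs[symmetric])
qed

lemma APU_cube_prod:
  assumes fin: "finite S" "finite T" and disj: "S \<inter> T = {}"
    and cubes: "measure_on_cube S \<mu>" "measure_on_cube T \<nu>"
    and "APU S \<mu>" "APU T \<nu>"
  shows "APU (S \<union> T) (cube_prod S T \<mu> \<nu>)"
proof -
  have card: "card (S \<union> T) = card S + card T" using fin disj by (rule card_Un_disjoint)
  have "antipodal_avg (S \<union> T) (cube_prod S T \<mu> \<nu>) k \<le> antipodal_avg (S \<union> T) (cube_prod S T \<mu> \<nu>) (Suc k)"
    if k: "2 * k < card S + card T" for k
  proof -
    have "path_sum (card S) (card T) (antipodal_avg S \<mu>) (antipodal_avg T \<nu>) k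
        \<le> path_sum (card S) (card T) (antipodal_avg S \<mu>) (antipodal_avg T \<nu>) (Suc k)"
      using assms k
      by (intro path_sum_mono) (auto simp: APU_iff antipodal_avg_symmetric antipodal_avg_nonneg)
    then show ?thesis using k by (simp add: antipodal_avg_prod[OF assms(1-5)] divide_right_mono)
  qed
  then show ?thesis using fin by (simp add: APU_iff card)
qed

section \<open>Conditioning of product measures\<close>

lemma prob_pair_pmf_Times:
  "measure_pmf.prob (pair_pmf \<mu> \<nu>) (A \<times> B) = measure_pmf.prob \<mu> A * measure_pmf.prob \<nu> B"
proof -
  \<comment> \<open>Cutting down to the supports makes both sides of the rectangle countable, as
    \<open>measure_pmf_prob_product\<close> requires.\<close>
  have "measure_pmf.prob (pair_pmf \<mu> \<nu>) (A \<times> B)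
      = measure_pmf.prob (pair_pmf \<mu> \<nu>) ((A \<inter> set_pmf \<mu>) \<times> (B \<inter> set_pmf \<nu>))"
    by (subst measure_Int_set_pmf[symmetric]) (simp add: Times_Int_Times)
  also have "\<dots> = measure_pmf.prob \<mu> (A \<inter> set_pmf \<mu>) * measure_pmf.prob \<nu> (B \<inter> set_pmf \<nu>)"
    by (rule measure_pmf_prob_product) auto
  finally show ?thesis by (simp add: measure_Int_set_pmf)
qed

lemma prob_agreeing_cube_prod:
  assumes "S \<inter> T = {}" "I \<subseteq> S \<union> T"
  shows "measure_pmf.prob (cube_prod S T \<mu> \<nu>) (agreeing I \<xi>)
       = measure_pmf.prob \<mu> (agreeing (I \<inter> S) \<xi>) * measure_pmf.prob \<nu> (agreeing (I \<inter> T) \<xi>)"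
proof -
  have "merge S T -` agreeing I \<xi> = agreeing (I \<inter> S) \<xi> \<times> agreeing (I \<inter> T) \<xi>"
    using assms by (fastforce simp: agreeing_def merge_def split: if_splits)
  then show ?thesis by (simp add: cube_prod_def prob_pair_pmf_Times)
qed

lemma agreeing_restrict: "agreeing I (restrict \<xi> I) = agreeing I \<xi>"
  by (auto simp: agreeing_def)

lemma measure_on_cube_conditioned:
  assumes "measure_on_cube U \<rho>" "measure_pmf.prob \<rho> (agreeing I \<xi>) > 0"
  shows "measure_on_cube (U - I) (conditioned U I \<xi> \<rho>)"
proof -
  have ne: "set_pmf \<rho> \<inter> agreeing I \<xi> \<noteq> {}"
    using assms(2) by (metis measure_Int_set_pmf inf_commute measure_empty less_irrefl)
  show ?thesis
    using assms(1) restrict_in_cube[of _ U "U - I"]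
    by (auto simp: measure_on_cube_def conditioned_def set_cond_pmf[OF ne])
qed

lemma pmf_outside_cube: "measure_on_cube U \<rho> \<Longrightarrow> \<eta> \<notin> cube U \<Longrightarrow> pmf \<rho> \<eta> = 0"
  by (auto simp: measure_on_cube_def set_pmf_iff)

text \<open>Pointwise comparison: both densities vanish off the cube, and on it the density and the
  probability of the event both factor.\<close>

lemma conditioned_cube_prod:
  assumes disj: "S \<inter> T = {}" and cubes: "measure_on_cube S \<mu>" "measure_on_cube T \<nu>"
    and I: "I \<subseteq> S \<union> T" and \<xi>: "\<xi> \<in> cube I"
    and pos: "measure_pmf.prob \<mu> (agreeing (I \<inter> S) \<xi>) > 0" "measure_pmf.prob \<nu> (agreeing (I \<inter> T) \<xi>) > 0"
  shows "conditioned (S \<union> T) I \<xi> (cube_prod S T \<mu> \<nu>)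
       = cube_prod (S - I) (T - I) (conditioned S (I \<inter> S) (restrict \<xi> (I \<inter> S)) \<mu>)
           (conditioned T (I \<inter> T) (restrict \<xi> (I \<inter> T)) \<nu>)" (is "?L = ?R")
proof (rule pmf_eqI)
  fix \<zeta>
  let ?\<xi>S = "restrict \<xi> (I \<inter> S)" and ?\<xi>T = "restrict \<xi> (I \<inter> T)"
  let ?\<mu> = "conditioned S (I \<inter> S) ?\<xi>S \<mu>" and ?\<nu> = "conditioned T (I \<inter> T) ?\<xi>T \<nu>"
  let ?pS = "measure_pmf.prob \<mu> (agreeing (I \<inter> S) \<xi>)" and ?pT = "measure_pmf.prob \<nu> (agreeing (I \<inter> T) \<xi>)"
  have U: "S \<union> T - I = (S - I) \<union> (T - I)" and SI: "S - I \<inter> S = S - I" and TI: "T - I \<inter> T = T - I"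
    by auto
  have posP: "measure_pmf.prob (cube_prod S T \<mu> \<nu>) (agreeing I \<xi>) > 0"
    using pos by (simp add: prob_agreeing_cube_prod[OF disj I])
  have onS: "measure_on_cube (S - I) ?\<mu>"
    using measure_on_cube_conditioned[OF cubes(1), of "I \<inter> S" ?\<xi>S] pos by (simp add: agreeing_restrict SI)
  have onT: "measure_on_cube (T - I) ?\<nu>"
    using measure_on_cube_conditioned[OF cubes(2), of "I \<inter> T" ?\<xi>T] pos by (simp add: agreeing_restrict TI)
  have onL: "measure_on_cube (S \<union> T - I) ?L"
    by (rule measure_on_cube_conditioned[OF measure_on_cube_prod[OF cubes] posP])
  have onR: "measure_on_cube (S \<union> T - I) ?R"
    unfolding U by (rule measure_on_cube_prod[OF onS onT])
  show "pmf ?L \<zeta> = pmf ?R \<zeta>"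
  proof (cases "\<zeta> \<in> cube (S \<union> T - I)")
    case False
    then show ?thesis using onL onR by (simp add: pmf_outside_cube)
  next
    case True
    let ?\<zeta>S = "restrict \<zeta> (S - I)" and ?\<zeta>T = "restrict \<zeta> (T - I)"
    let ?a = "merge (I \<inter> S) (S - I) (?\<xi>S, ?\<zeta>S)" and ?b = "merge (I \<inter> T) (T - I) (?\<xi>T, ?\<zeta>T)"
    have in_cubes: "?\<zeta>S \<in> cube (S - I)" "?\<zeta>T \<in> cube (T - I)" "?\<xi>S \<in> cube (I \<inter> S)" "?\<xi>T \<in> cube (I \<inter> T)"
      using True \<xi> by (auto intro!: restrict_in_cube)
    have ab: "?a \<in> cube S" "?b \<in> cube T"
      using merge_in_cube[OF in_cubes(3,1)] merge_in_cube[OF in_cubes(4,2)]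
      by (metis Int_commute Un_Diff_Int Un_commute)+
    \<comment> \<open>The same point glued in two orders: fixed with free coordinates, or part on
      \<open>S\<close> with part on \<open>T\<close>.\<close>
    have "merge I (S \<union> T - I) (\<xi>, \<zeta>) = merge S T (?a, ?b)"
      using I disj by (auto simp: merge_def fun_eq_iff)
    then have "pmf ?L \<zeta> = pmf \<mu> ?a * pmf \<nu> ?b / (?pS * ?pT)"
      using pmf_conditioned[OF I measure_on_cube_prod[OF cubes] \<xi> True posP]
      by (simp only: prob_agreeing_cube_prod[OF disj I] pmf_cube_prod[OF disj cubes ab])
    also have "\<dots> = pmf ?\<mu> ?\<zeta>S * pmf ?\<nu> ?\<zeta>T"
      using pmf_conditioned[OF _ cubes(1) in_cubes(3), of ?\<zeta>S] pmf_conditioned[OF _ cubes(2) in_cubes(4), of ?\<zeta>T]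
        in_cubes pos by (simp add: agreeing_restrict SI TI)
    also have "\<dots> = pmf ?R (merge (S - I) (T - I) (?\<zeta>S, ?\<zeta>T))"
      using disj by (intro pmf_cube_prod[OF _ onS onT in_cubes(1,2), symmetric]) auto
    also have "merge (S - I) (T - I) (?\<zeta>S, ?\<zeta>T) = \<zeta>"
      using True by (simp add: U restrict_cube)
    finally show ?thesis .
  qed
qed

lemma CAPU_cube_prod:
  assumes fin: "finite S" "finite T" and disj: "S \<inter> T = {}"
    and cubes: "measure_on_cube S \<mu>" "measure_on_cube T \<nu>"
    and C: "CAPU S \<mu>" "CAPU T \<nu>"
  shows "CAPU (S \<union> T) (cube_prod S T \<mu> \<nu>)"
  unfolding CAPU_def
proof (intro allI impI, elim conjE)
  fix I \<xi>
  assume I: "I \<subseteq> S \<union> T" and \<xi>: "\<xi> \<in> cube I"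
    and "measure_pmf.prob (cube_prod S T \<mu> \<nu>) (agreeing I \<xi>) > 0"
  then have pos: "measure_pmf.prob \<mu> (agreeing (I \<inter> S) \<xi>) > 0" "measure_pmf.prob \<nu> (agreeing (I \<inter> T) \<xi>) > 0"
    by (auto simp: prob_agreeing_cube_prod[OF disj I] zero_less_mult_iff not_less[symmetric])
  let ?\<mu> = "conditioned S (I \<inter> S) (restrict \<xi> (I \<inter> S)) \<mu>"
  let ?\<nu> = "conditioned T (I \<inter> T) (restrict \<xi> (I \<inter> T)) \<nu>"
  have minus: "S - I \<inter> S = S - I" "T - I \<inter> T = T - I" "S \<union> T - I = (S - I) \<union> (T - I)"
    by auto
  \<comment> \<open>Restricting \<open>\<xi>\<close> leaves the events unchanged and yields members
    of the cubes over which \<open>CAPU\<close> quantifies.\<close>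
  have r: "restrict \<xi> (I \<inter> S) \<in> cube (I \<inter> S)" "restrict \<xi> (I \<inter> T) \<in> cube (I \<inter> T)"
    using \<xi> by (auto intro: restrict_in_cube)
  have on: "measure_on_cube (S - I) ?\<mu>" "measure_on_cube (T - I) ?\<nu>"
    using measure_on_cube_conditioned[OF cubes(1), of "I \<inter> S" "restrict \<xi> (I \<inter> S)"]
      measure_on_cube_conditioned[OF cubes(2), of "I \<inter> T" "restrict \<xi> (I \<inter> T)"] pos
    by (simp_all add: agreeing_restrict minus)
  have apu: "APU (S - I) ?\<mu>" "APU (T - I) ?\<nu>"
    using C r pos unfolding CAPU_def by (metis Int_lower2 agreeing_restrict minus(1,2))+
  show "APU (S \<union> T - I) (conditioned (S \<union> T) I \<xi> (cube_prod S T \<mu> \<nu>))"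
    unfolding conditioned_cube_prod[OF disj cubes I \<xi> pos] minus(3)
    using fin disj on apu by (intro APU_cube_prod) auto
qed

theorem theorem4p2:
  fixes S T :: "'a set" and \<mu> \<nu> :: "('a \<Rightarrow> nat) pmf"
  assumes "finite S" and "finite T" and "S \<inter> T = {}"
    and "measure_on_cube S \<mu>" and "measure_on_cube T \<nu>"
  shows "(APU S \<mu> \<and> APU T \<nu> \<longrightarrow> APU (S \<union> T) (cube_prod S T \<mu> \<nu>)) \<and>
         (CAPU S \<mu> \<and> CAPU T \<nu> \<longrightarrow> CAPU (S \<union> T) (cube_prod S T \<mu> \<nu>))"
  using APU_cube_prod[OF assms] CAPU_cube_prod[OF assms] by blast

end
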